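(* Let $B$ be a left semi-brace. Then $E$ is an ideal of $B$ if and only if there exists an idempotent endomorphism $\varphi$ of the group $(B,\circ)$ (that is, $\varphi\circ\varphi=\varphi$ as maps) such that $G=\operatorname{Im}\varphi$ and $E=\operatorname{Ker}\varphi$. Furthermore, in this case $\varphi=\rho_0$.
   Context: A left semi-brace is a set $B$ with two operations $+$ and $\circ$ such that $(B,+)$ is a left cancellative semigroup (not necessarily commutative), $(B,\circ)$ is a group, and $a\circ(b+c)=a\circ b+a\circ(a^-+c)$ for all $a,b,c\in B$, where $a^-$ is the inverse of $a$ in $(B,\circ)$ and $\circ$ has higher precedence than $+$. The identity of $(B,\circ)$ is denoted $0$; it is an idempotent and a left identity of $(B,+)$. Let $E$ be the set of idempotents of $(B,+)$ and $G=B+0=\{b+0: b\in B\}$, which is a subgroup of $(B,+)$ (with identity $0$). For $a,b\in B$ put $\lambda_a(b)=a\circ(a^-+b)$ and $\rho_b(a)=(a^-+b)^-\circ b$; in particular $\rho_0(b)=(b^-+0)^-$. A subsemigroup $I$ of $(B,+)$ is an ideal of $B$ if: (i) $I$ is a normal subgroup of $(B,\circ)$; (ii) $I\cap G$ is a normal subgroup of $(G,+)$; (iii) $\rho_b(n)\in I$ for all $b\in B$, $n\in I\cap G$; (iv) $\lambda_g(e)\in I$ for all $g\in G$, $e\in I\cap E$. *)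

theory Defs
  imports "HOL-Algebra.Coset"
begin

text \<open>
  The inherited monoid structure is the circle operation, so that
  \<open>\<one>\<close> is the element usually written \<open>0\<close> and
  \<open>inv\<close> is the inverse \<open>a\<^sup>-\<close>. The additional field is the
  (in general non-commutative) addition.
\<close>

record 'a semi_brace = "'a monoid" +
  sadd :: "['a, 'a] \<Rightarrow> 'a"  (infixl "\<boxplus>\<index>" 65)

locale left_semi_brace = group B for B :: "('a, 'm) semi_brace_scheme" (structure) +
  assumes sadd_closed: "\<lbrakk>a \<in> carrier B; b \<in> carrier B\<rbrakk> \<Longrightarrow> a \<boxplus> b \<in> carrier B"
    and sadd_assoc: "\<lbrakk>a \<in> carrier B; b \<in> carrier B; c \<in> carrier B\<rbrakk>
      \<Longrightarrow> (a \<boxplus> b) \<boxplus> c = a \<boxplus> (b \<boxplus> c)"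
    and sadd_left_cancel: "\<lbrakk>a \<in> carrier B; b \<in> carrier B; c \<in> carrier B; a \<boxplus> b = a \<boxplus> c\<rbrakk>
      \<Longrightarrow> b = c"
    and circ_sadd: "\<lbrakk>a \<in> carrier B; b \<in> carrier B; c \<in> carrier B\<rbrakk>
      \<Longrightarrow> a \<otimes> (b \<boxplus> c) = (a \<otimes> b) \<boxplus> (a \<otimes> (inv a \<boxplus> c))"

definition idem_part :: "('a, 'm) semi_brace_scheme \<Rightarrow> 'a set" where
  "idem_part B = {e \<in> carrier B. e \<boxplus>\<^bsub>B\<^esub> e = e}"

definition group_part :: "('a, 'm) semi_brace_scheme \<Rightarrow> 'a set" where
  "group_part B = {b \<boxplus>\<^bsub>B\<^esub> \<one>\<^bsub>B\<^esub> | b. b \<in> carrier B}"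

definition add_group_part :: "('a, 'm) semi_brace_scheme \<Rightarrow> 'a monoid" where
  "add_group_part B = \<lparr>carrier = group_part B, mult = sadd B, one = \<one>\<^bsub>B\<^esub>\<rparr>"

definition lambda_map :: "('a, 'm) semi_brace_scheme \<Rightarrow> 'a \<Rightarrow> 'a \<Rightarrow> 'a" where
  "lambda_map B a b = a \<otimes>\<^bsub>B\<^esub> (inv\<^bsub>B\<^esub> a \<boxplus>\<^bsub>B\<^esub> b)"

definition rho_map :: "('a, 'm) semi_brace_scheme \<Rightarrow> 'a \<Rightarrow> 'a \<Rightarrow> 'a" where
  "rho_map B b a = inv\<^bsub>B\<^esub> (inv\<^bsub>B\<^esub> a \<boxplus>\<^bsub>B\<^esub> b) \<otimes>\<^bsub>B\<^esub> b"

definition semi_brace_ideal :: "'a set \<Rightarrow> ('a, 'm) semi_brace_scheme \<Rightarrow> bool" where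
  "semi_brace_ideal I B \<longleftrightarrow>
     I \<subseteq> carrier B \<and>
     (\<forall>x\<in>I. \<forall>y\<in>I. x \<boxplus>\<^bsub>B\<^esub> y \<in> I) \<and>
     I \<lhd> B \<and>
     (I \<inter> group_part B) \<lhd> add_group_part B \<and>
     (\<forall>b\<in>carrier B. \<forall>n\<in>I \<inter> group_part B. rho_map B b n \<in> I) \<and>
     (\<forall>g\<in>group_part B. \<forall>e\<in>I \<inter> idem_part B. lambda_map B g e \<in> I)"

definition idempotent_endomorphism :: "('a, 'm) monoid_scheme \<Rightarrow> ('a \<Rightarrow> 'a) \<Rightarrow> bool" where
  "idempotent_endomorphism H \<phi> \<longleftrightarrow>
     \<phi> \<in> hom H H \<and> (\<forall>x\<in>carrier H. \<phi> (\<phi> x) = \<phi> x)"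

context left_semi_brace
begin

lemma one_sadd:
  assumes c: "c \<in> carrier B"
  shows "\<one> \<boxplus> c = c"
proof (rule sadd_left_cancel)
  have "\<one> \<boxplus> c = \<one> \<otimes> (\<one> \<boxplus> c)"
    using c by (simp add: sadd_closed)
  also have "\<dots> = (\<one> \<otimes> \<one>) \<boxplus> (\<one> \<otimes> (inv \<one> \<boxplus> c))"
    using c by (intro circ_sadd) simp_all
  also have "\<dots> = \<one> \<boxplus> (\<one> \<boxplus> c)"
    using c by (simp add: sadd_closed)
  finally show "\<one> \<boxplus> (\<one> \<boxplus> c) = \<one> \<boxplus> c" by (rule sym)
qed (use c in \<open>simp_all add: sadd_closed\<close>)

lemma sadd_lambda_map:
  assumes "a \<in> carrier B" "b \<in> carrier B"
  shows "a \<boxplus> lambda_map B a b = a \<otimes> b"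
proof -
  have "a \<otimes> b = a \<otimes> (\<one> \<boxplus> b)"
    by (simp only: one_sadd[OF assms(2)])
  also have "\<dots> = (a \<otimes> \<one>) \<boxplus> (a \<otimes> (inv a \<boxplus> b))"
    using assms by (intro circ_sadd) simp_all
  also have "\<dots> = a \<boxplus> lambda_map B a b"
    by (simp only: lambda_map_def r_one[OF assms(1)])
  finally show ?thesis by (rule sym)
qed

lemma group_part_iff: "x \<in> group_part B \<longleftrightarrow> x \<in> carrier B \<and> x \<boxplus> \<one> = x"
proof
  assume "x \<in> group_part B"
  then obtain b where b: "b \<in> carrier B" "x = b \<boxplus> \<one>"
    unfolding group_part_def by blast
  have "b \<boxplus> \<one> \<boxplus> \<one> = b \<boxplus> (\<one> \<boxplus> \<one>)"
    by (rule sadd_assoc[OF b(1) one_closed one_closed])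
  then show "x \<in> carrier B \<and> x \<boxplus> \<one> = x"
    using b sadd_closed[OF b(1) one_closed] by (simp only: one_sadd[OF one_closed] simp_thms)
next
  assume "x \<in> carrier B \<and> x \<boxplus> \<one> = x"
  then show "x \<in> group_part B"
    unfolding group_part_def by (intro CollectI exI[of _ x]) metis
qed

lemma group_add_group_part: "group (add_group_part B)"
proof -
  have cl: "x \<in> carrier B" and right_id: "x \<boxplus> \<one> = x" if "x \<in> group_part B" for x
    using that group_part_iff by blast+
  have right_inv: "\<exists>y\<in>group_part B. x \<boxplus> y = \<one>" if x: "x \<in> group_part B" for x
  proof (rule bexI)
    let ?y = "lambda_map B x (inv x)"
    have y: "?y \<in> carrier B"
      unfolding lambda_map_def using cl[OF x] by (intro m_closed sadd_closed inv_closed)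
    show "?y \<boxplus> \<one> \<in> group_part B"
      unfolding group_part_def using y by blast
    have "x \<boxplus> (?y \<boxplus> \<one>) = x \<boxplus> ?y \<boxplus> \<one>"
      by (rule sadd_assoc[symmetric, OF cl[OF x] y one_closed])
    also have "\<dots> = \<one>"
      by (simp only: sadd_lambda_map cl[OF x] inv_closed r_inv one_sadd one_closed)
    finally show "x \<boxplus> (?y \<boxplus> \<one>) = \<one>" .
  qed
  have left_inv: "\<exists>y\<in>group_part B. y \<boxplus> x = \<one>" if x: "x \<in> group_part B" for x
  proof -
    obtain y where y: "y \<in> group_part B" "x \<boxplus> y = \<one>"
      using right_inv[OF x] by blast
    have "x \<boxplus> (y \<boxplus> x) = x \<boxplus> \<one>"
      using sadd_assoc[OF cl[OF x] cl[OF y(1)] cl[OF x]]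
      by (simp only: y(2) one_sadd[OF cl[OF x]] right_id[OF x])
    then have "y \<boxplus> x = \<one>"
      using sadd_left_cancel[of x "y \<boxplus> x" \<one>] cl[OF x] cl[OF y(1)] sadd_closed one_closed
      by blast
    with y(1) show ?thesis by blast
  qed
  show ?thesis
  proof (rule groupI, unfold add_group_part_def partial_object.simps monoid.simps)
    fix x y assume x: "x \<in> group_part B" and y: "y \<in> group_part B"
    show "x \<boxplus> y \<in> group_part B"
      unfolding group_part_iff sadd_assoc[OF cl[OF x] cl[OF y] one_closed] right_id[OF y]
      using sadd_closed[OF cl[OF x] cl[OF y]] by (rule conjI) (rule refl)
    show "(x \<boxplus> y) \<boxplus> z = x \<boxplus> (y \<boxplus> z)" if "z \<in> group_part B" for z
      by (rule sadd_assoc[OF cl[OF x] cl[OF y] cl[OF that]])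
    show "\<one> \<boxplus> x = x"
      by (rule one_sadd[OF cl[OF x]])
    show "\<exists>y\<in>group_part B. y \<boxplus> x = \<one>"
      by (rule left_inv[OF x])
  next
    show "\<one> \<in> group_part B"
      unfolding group_part_iff using one_closed one_sadd[OF one_closed] by (rule conjI)
  qed
qed

end

end

theory Submission
  imports Defs
begin

text \<open>
  Every \<open>\<lambda>\<^sub>a\<close> is an additive automorphism, \<open>a \<mapsto> \<lambda>\<^sub>a\<close> is a homomorphism, and
  \<open>a + \<lambda>\<^sub>a(b) = a \<circ> b\<close>. Since the idempotents are exactly the left identities of addition and
  \<open>G\<close> is exactly the set of \<open>a\<close> with \<open>\<lambda>\<^sub>a(0) = 0\<close>, it follows that \<open>G\<close> and \<open>E\<close> are subgroups of
  the multiplicative group, that they meet only in \<open>0\<close>, and that every \<open>b\<close> factorises as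
  \<open>e \<circ> \<rho>\<^sub>0(b)\<close> with \<open>e \<in> E\<close> and \<open>\<rho>\<^sub>0(b) \<in> G\<close> (\<open>circ_factorisation\<close>); moreover
  \<open>\<rho>\<^sub>0(e \<circ> g) = g\<close> for \<open>e \<in> E\<close>, \<open>g \<in> G\<close> (\<open>rho_one_circ\<close>). So \<open>\<rho>\<^sub>0\<close> is the projection onto
  \<open>G\<close> along \<open>E\<close> of an exact factorisation of the group.

  Because \<open>E \<inter> G\<close> is trivial and every \<open>\<lambda>\<^sub>a\<close> preserves \<open>E\<close>, all conditions for \<open>E\<close> to be an
  ideal hold automatically, except normality in the multiplicative group
  (\<open>ideal_idem_part_iff_normal\<close>). If \<open>E\<close> is normal, the factorisation is a semidirect
  decomposition, and the projection \<open>\<rho>\<^sub>0\<close> is an endomorphism. Conversely the kernel of an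
  endomorphism is normal. An idempotent endomorphism with image \<open>G\<close> and kernel \<open>E\<close> kills \<open>e\<close>
  and fixes \<open>\<rho>\<^sub>0(b)\<close> in the factorisation of \<open>b\<close>, hence equals \<open>\<rho>\<^sub>0\<close>.
\<close>

context left_semi_brace
begin

section \<open>The action by the maps \<open>\<lambda>\<^sub>a\<close>\<close>

lemma lambda_closed:
  assumes "a \<in> carrier B" "b \<in> carrier B"
  shows "lambda_map B a b \<in> carrier B"
  unfolding lambda_map_def using assms by (simp add: sadd_closed)

lemma lambda_sadd:
  assumes "a \<in> carrier B" "b \<in> carrier B" "c \<in> carrier B"
  shows "lambda_map B a (b \<boxplus> c) = lambda_map B a b \<boxplus> lambda_map B a c"
proof -
  have "a \<otimes> (inv a \<boxplus> (b \<boxplus> c)) = a \<otimes> ((inv a \<boxplus> b) \<boxplus> c)"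
    using assms by (simp add: sadd_assoc)
  also have "\<dots> = (a \<otimes> (inv a \<boxplus> b)) \<boxplus> (a \<otimes> (inv a \<boxplus> c))"
    using assms by (intro circ_sadd) (simp_all add: sadd_closed)
  finally show ?thesis unfolding lambda_map_def .
qed

lemma lambda_circ:
  assumes "a \<in> carrier B" "b \<in> carrier B" "c \<in> carrier B"
  shows "lambda_map B (a \<otimes> b) c = lambda_map B a (lambda_map B b c)"
proof (rule sadd_left_cancel)
  have "(a \<otimes> b) \<boxplus> lambda_map B (a \<otimes> b) c = a \<otimes> (b \<otimes> c)"
    using assms by (simp add: sadd_lambda_map m_assoc)
  also have "\<dots> = a \<boxplus> lambda_map B a (b \<boxplus> lambda_map B b c)"
    using assms by (simp add: sadd_lambda_map)
  also have "\<dots> = (a \<boxplus> lambda_map B a b) \<boxplus> lambda_map B a (lambda_map B b c)"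
    using assms by (simp add: lambda_sadd lambda_closed sadd_assoc)
  also have "\<dots> = (a \<otimes> b) \<boxplus> lambda_map B a (lambda_map B b c)"
    using assms by (simp add: sadd_lambda_map)
  finally show "(a \<otimes> b) \<boxplus> lambda_map B (a \<otimes> b) c
    = (a \<otimes> b) \<boxplus> lambda_map B a (lambda_map B b c)" .
qed (use assms in \<open>simp_all add: lambda_closed\<close>)

lemma lambda_one: "c \<in> carrier B \<Longrightarrow> lambda_map B \<one> c = c"
  by (simp add: lambda_map_def one_sadd)

lemma lambda_inv_lambda:
  assumes "a \<in> carrier B" "c \<in> carrier B"
  shows "lambda_map B (inv a) (lambda_map B a c) = c"
  using assms by (simp add: lambda_circ[symmetric] lambda_one)

section \<open>The subgroups of idempotents and of stabilisers\<close>

lemma idem_part_iff_left_identity: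
  "e \<in> idem_part B \<longleftrightarrow> e \<in> carrier B \<and> (\<forall>b\<in>carrier B. e \<boxplus> b = b)"
proof
  assume "e \<in> idem_part B"
  then have e: "e \<in> carrier B" "e \<boxplus> e = e" by (auto simp: idem_part_def)
  have "e \<boxplus> b = b" if b: "b \<in> carrier B" for b
  proof (rule sadd_left_cancel)
    show "e \<boxplus> (e \<boxplus> b) = e \<boxplus> b"
      using sadd_assoc[OF e(1) e(1) b] e(2) by simp
  qed (use e b in \<open>simp_all add: sadd_closed\<close>)
  with e show "e \<in> carrier B \<and> (\<forall>b\<in>carrier B. e \<boxplus> b = b)" by blast
qed (auto simp: idem_part_def)

lemma idem_part_carrier: "e \<in> idem_part B \<Longrightarrow> e \<in> carrier B"
  by (simp add: idem_part_def)

lemma idem_part_sadd: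
  "e \<in> idem_part B \<Longrightarrow> b \<in> carrier B \<Longrightarrow> e \<boxplus> b = b"
  by (simp add: idem_part_iff_left_identity)

lemma one_in_idem_part: "\<one> \<in> idem_part B"
  by (simp add: idem_part_def one_sadd)

lemma lambda_idem_part:
  assumes "a \<in> carrier B" "e \<in> idem_part B"
  shows "lambda_map B a e \<in> idem_part B"
  using lambda_sadd[of a e e] lambda_closed[of a e] assms by (simp add: idem_part_def)

lemma idem_part_inv:
  assumes e: "e \<in> idem_part B"
  shows "inv e \<in> idem_part B"
proof -
  note ec = idem_part_carrier[OF e]
  have "lambda_map B e (inv e) = e \<boxplus> lambda_map B e (inv e)"
    using e ec by (simp add: idem_part_sadd lambda_closed)
  also have "\<dots> = \<one>"
    using ec by (simp add: sadd_lambda_map)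
  finally have "inv e = lambda_map B (inv e) \<one>"
    using lambda_inv_lambda[of e "inv e"] ec by simp
  then show ?thesis
    using lambda_idem_part[of "inv e" \<one>] ec one_in_idem_part by simp
qed

lemma idem_part_Int_group_part: "idem_part B \<inter> group_part B = {\<one>}"
  using one_in_idem_part idem_part_sadd[OF _ one_closed]
  by (auto simp: group_part_iff one_sadd)

text \<open>The part \<open>G\<close> is the stabiliser of \<open>0\<close> under the action \<open>\<lambda>\<close>.\<close>

lemma group_part_iff_lambda:
  "a \<in> group_part B \<longleftrightarrow> a \<in> carrier B \<and> lambda_map B a \<one> = \<one>"
proof -
  have "a \<boxplus> \<one> = a \<longleftrightarrow> lambda_map B a \<one> = \<one>" if a: "a \<in> carrier B"
  proof -
    have stab: "a \<boxplus> lambda_map B a \<one> = a" using a by (simp add: sadd_lambda_map)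
    then show ?thesis
      using sadd_left_cancel[OF a lambda_closed[OF a one_closed] one_closed] by auto
  qed
  then show ?thesis by (auto simp: group_part_iff)
qed

lemma group_part_inv:
  assumes "g \<in> group_part B"
  shows "inv g \<in> group_part B"
  using assms lambda_inv_lambda[of g \<one>] by (simp add: group_part_iff_lambda)

lemma group_part_circ:
  assumes "g \<in> group_part B" "h \<in> group_part B"
  shows "g \<otimes> h \<in> group_part B"
  using assms by (simp add: group_part_iff_lambda lambda_circ)

section \<open>The projection \<open>\<rho>\<^sub>0\<close>\<close>

lemma rho_one: "b \<in> carrier B \<Longrightarrow> rho_map B \<one> b = inv (inv b \<boxplus> \<one>)"
  by (simp add: rho_map_def sadd_closed)

lemma rho_one_in_group_part:
  assumes "b \<in> carrier B"
  shows "rho_map B \<one> b \<in> group_part B"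
proof -
  have "inv b \<boxplus> \<one> \<in> group_part B"
    using assms by (auto simp: group_part_def)
  then show ?thesis using assms by (simp add: rho_one group_part_inv)
qed

lemma circ_factorisation:
  assumes b: "b \<in> carrier B"
  obtains e where "e \<in> idem_part B" "b = e \<otimes> rho_map B \<one> b"
proof
  define g where "g = inv b \<boxplus> \<one>"
  \<comment> \<open>Additively, \<open>inv b = g \<boxplus> f\<close> with \<open>f\<close> idempotent; multiplicatively, \<open>inv b = g \<otimes> h\<close>
    with \<open>h\<close> idempotent. Inverting the latter gives the claim.\<close>
  define f where "f = lambda_map B (inv b) \<one>"
  define h where "h = lambda_map B (inv g) f"
  have g: "g \<in> carrier B" using b by (simp add: g_def sadd_closed)
  have f: "f \<in> idem_part B"
    unfolding f_def using b by (simp add: lambda_idem_part one_in_idem_part)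
  then have h: "h \<in> idem_part B"
    unfolding h_def using g by (simp add: lambda_idem_part)
  note fc = idem_part_carrier[OF f] and hc = idem_part_carrier[OF h]
  show "inv h \<in> idem_part B" by (rule idem_part_inv[OF h])
  have "lambda_map B g h = f"
    unfolding h_def using lambda_inv_lambda[of "inv g" f] g fc by simp
  then have "g \<otimes> h = g \<boxplus> f"
    using sadd_lambda_map[OF g hc] by simp
  also have "\<dots> = inv b \<boxplus> f"
    using b fc by (simp add: g_def sadd_assoc one_sadd)
  also have "\<dots> = inv b"
    using b by (simp add: f_def sadd_lambda_map)
  finally have "inv (g \<otimes> h) = b" using b by simp
  then show "b = inv h \<otimes> rho_map B \<one> b"
    using b g hc by (simp add: rho_one g_def[symmetric] inv_mult_group)
qed

lemma rho_one_circ: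
  assumes e: "e \<in> idem_part B" and g: "g \<in> group_part B"
  shows "rho_map B \<one> (e \<otimes> g) = g"
proof -
  have ec: "e \<in> carrier B" and gc: "g \<in> carrier B"
    using e g by (simp_all add: idem_part_carrier group_part_iff)
  let ?f = "lambda_map B (inv g) (inv e)"
  have f: "?f \<in> idem_part B"
    using gc idem_part_inv[OF e] by (simp add: lambda_idem_part)
  have "inv (e \<otimes> g) \<boxplus> \<one> = (inv g \<boxplus> ?f) \<boxplus> \<one>"
    using ec gc by (simp add: inv_mult_group sadd_lambda_map)
  also have "\<dots> = inv g \<boxplus> \<one>"
    using gc f by (simp add: sadd_assoc idem_part_carrier idem_part_sadd)
  also have "\<dots> = inv g"
    using group_part_inv[OF g] by (simp add: group_part_iff)
  finally show ?thesis using ec gc by (simp add: rho_one)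
qed

lemma rho_one_group_part: "g \<in> group_part B \<Longrightarrow> rho_map B \<one> g = g"
  using rho_one_circ[OF one_in_idem_part, of g] by (simp add: group_part_iff)

lemma image_rho_one: "rho_map B \<one> ` carrier B = group_part B"
proof
  show "group_part B \<subseteq> rho_map B \<one> ` carrier B"
    using rho_one_group_part by (force simp: group_part_iff)
qed (auto simp: rho_one_in_group_part)

lemma kernel_rho_one: "kernel B B (rho_map B \<one>) = idem_part B"
proof
  show "kernel B B (rho_map B \<one>) \<subseteq> idem_part B"
  proof
    fix b assume "b \<in> kernel B B (rho_map B \<one>)"
    then have b: "b \<in> carrier B" "rho_map B \<one> b = \<one>" by (auto simp: kernel_def)
    from b(1) obtain e where e: "e \<in> idem_part B" "b = e \<otimes> rho_map B \<one> b"
      by (rule circ_factorisation)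
    then have "b = e" using b(2) by (simp add: idem_part_carrier)
    with e(1) show "b \<in> idem_part B" by simp
  qed
  show "idem_part B \<subseteq> kernel B B (rho_map B \<one>)"
  proof
    fix e assume e: "e \<in> idem_part B"
    have "\<one> \<in> group_part B" using idem_part_Int_group_part by blast
    then have "rho_map B \<one> e = \<one>"
      using rho_one_circ[OF e, of \<one>] e by (simp add: idem_part_carrier)
    then show "e \<in> kernel B B (rho_map B \<one>)"
      using e by (simp add: kernel_def idem_part_carrier)
  qed
qed

section \<open>Normality and endomorphisms\<close>

lemma ideal_idem_part_iff_normal:
  "semi_brace_ideal (idem_part B) B \<longleftrightarrow> idem_part B \<lhd> B"
proof
  assume normal: "idem_part B \<lhd> B"
  have "{\<one>} \<lhd> add_group_part B"
    using group.one_is_normal[OF group_add_group_part] by (simp add: add_group_part_def)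
  moreover have "rho_map B b \<one> = \<one>" if "b \<in> carrier B" for b
    using that by (simp add: rho_map_def one_sadd)
  moreover have "lambda_map B g e \<in> idem_part B"
    if "g \<in> group_part B" "e \<in> idem_part B" for g e
    using that by (simp add: lambda_idem_part group_part_iff)
  ultimately show "semi_brace_ideal (idem_part B) B"
    unfolding semi_brace_ideal_def idem_part_Int_group_part
    using normal by (auto simp: idem_part_carrier idem_part_sadd one_in_idem_part)
qed (simp add: semi_brace_ideal_def)

lemma rho_one_hom:
  assumes normal: "idem_part B \<lhd> B"
  shows "rho_map B \<one> \<in> hom B B"
proof (rule homI)
  interpret E: normal "idem_part B" B by (rule normal)
  fix a b assume a: "a \<in> carrier B" and b: "b \<in> carrier B"
  let ?g = "rho_map B \<one> a" and ?h = "rho_map B \<one> b"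
  have G: "?g \<in> group_part B" "?h \<in> group_part B"
    using a b by (simp_all add: rho_one_in_group_part)
  then have gh: "?g \<in> carrier B" "?h \<in> carrier B"
    by (simp_all add: group_part_iff)
  then show "?g \<in> carrier B" by simp
  obtain e where e: "e \<in> idem_part B" "a = e \<otimes> ?g"
    using a by (rule circ_factorisation)
  obtain f where f: "f \<in> idem_part B" "b = f \<otimes> ?h"
    using b by (rule circ_factorisation)
  note efc = e(1)[THEN idem_part_carrier] f(1)[THEN idem_part_carrier]
  \<comment> \<open>Moving \<open>f\<close> across \<open>?g\<close> by conjugation gives \<open>a \<otimes> b = ?k \<otimes> (?g \<otimes> ?h)\<close>.\<close>
  let ?k = "e \<otimes> (?g \<otimes> f \<otimes> inv ?g)"
  have k: "?k \<in> idem_part B"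
    using e(1) E.inv_op_closed2[OF gh(1) f(1)] by (rule E.m_closed)
  have "?k \<otimes> (?g \<otimes> ?h) = (e \<otimes> ?g) \<otimes> (f \<otimes> ?h)"
    using efc gh by (simp add: m_assoc inv_solve_left')
  also have "\<dots> = a \<otimes> b" by (simp only: e(2)[symmetric] f(2)[symmetric])
  finally show "rho_map B \<one> (a \<otimes> b) = ?g \<otimes> ?h"
    using rho_one_circ[OF k group_part_circ[OF G]] by simp
qed

lemma idempotent_endomorphism_eq_rho_one:
  assumes endo: "idempotent_endomorphism B \<phi>"
    and im: "group_part B = \<phi> ` carrier B"
    and ker: "idem_part B = kernel B B \<phi>"
    and b: "b \<in> carrier B"
  shows "\<phi> b = rho_map B \<one> b"
proof -
  have hom: "\<phi> \<in> hom B B" and idem: "\<And>x. x \<in> carrier B \<Longrightarrow> \<phi> (\<phi> x) = \<phi> x"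
    using endo by (auto simp: idempotent_endomorphism_def)
  obtain e where e: "e \<in> idem_part B" "b = e \<otimes> rho_map B \<one> b"
    using b by (rule circ_factorisation)
  have g: "rho_map B \<one> b \<in> group_part B" using b by (rule rho_one_in_group_part)
  then have gc: "rho_map B \<one> b \<in> carrier B" by (simp add: group_part_iff)
  have "\<phi> b = \<phi> e \<otimes> \<phi> (rho_map B \<one> b)"
    using hom_mult[OF hom idem_part_carrier[OF e(1)] gc] e(2)[symmetric] by simp
  also have "\<phi> e = \<one>" using e(1) ker by (simp add: kernel_def)
  also have "\<phi> (rho_map B \<one> b) = rho_map B \<one> b" using g im idem by auto
  finally show ?thesis using gc by simp
qed

end

theorem theorem17:
  fixes B :: "('a, 'm) semi_brace_scheme"
  assumes "left_semi_brace B"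
  shows "(semi_brace_ideal (idem_part B) B \<longleftrightarrow>
           (\<exists>\<phi>. idempotent_endomorphism B \<phi> \<and>
                group_part B = \<phi> ` carrier B \<and> idem_part B = kernel B B \<phi>)) \<and>
         (\<forall>\<phi>. idempotent_endomorphism B \<phi> \<and>
              group_part B = \<phi> ` carrier B \<and> idem_part B = kernel B B \<phi> \<longrightarrow>
              (\<forall>b\<in>carrier B. \<phi> b = rho_map B \<one>\<^bsub>B\<^esub> b))"
proof -
  interpret left_semi_brace B by (rule assms)
  have "\<exists>\<phi>. idempotent_endomorphism B \<phi> \<and>
      group_part B = \<phi> ` carrier B \<and> idem_part B = kernel B B \<phi>"
    if "idem_part B \<lhd> B"
  proof (intro exI conjI)
    show "idempotent_endomorphism B (rho_map B \<one>\<^bsub>B\<^esub>)"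
      using rho_one_hom[OF that] rho_one_group_part rho_one_in_group_part
      by (simp add: idempotent_endomorphism_def)
  qed (simp_all add: image_rho_one kernel_rho_one)
  moreover have "idem_part B \<lhd> B"
    if "idempotent_endomorphism B \<phi>" "idem_part B = kernel B B \<phi>" for \<phi>
  proof -
    interpret group_hom B B \<phi>
      using that(1) by unfold_locales (simp add: idempotent_endomorphism_def)
    show ?thesis using normal_kernel that(2) by simp
  qed
  ultimately show ?thesis
    using ideal_idem_part_iff_normal idempotent_endomorphism_eq_rho_one by blast
qed

end
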